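(* Let $k \geq 2$, let $n_1,\ldots,n_k$ be positive integers and let $q$ be a positive integer. Assume that $G=K_{n_1,\ldots,n_k}$ has an equitable $q$-coloring. Then $p(q: n_1,\ldots,n_k)$ is the minimum $p$ such that $G$ has an equitable $r$-coloring for each integer $r$ satisfying $p \leq r \leq q$ (the minimum being over positive integers $p \le q$).
   Context: All graphs are finite, undirected and simple. $K_{n_1,\ldots,n_k}$ denotes the complete $k$-partite graph whose partite sets $X_1,\ldots,X_k$ have sizes $|X_i|=n_i$ for $1\le i\le k$ (two vertices are adjacent if and only if they lie in different partite sets). An equitable $q$-coloring of a graph is a proper vertex coloring with $q$ colors such that the sizes of every two of the $q$ color classes differ by at most $1$. Definition of $p(q: n_1,\ldots,n_k)$: assume that $K_{n_1,\ldots,n_k}$ has an equitable $q$-coloring. Let $d$ be the minimum integer with $d \geq \lceil (n_1+\cdots+n_k)/q \rceil$ such that at least one of the following holds: (i) there are distinct indices $i$ and $j$ such that neither $n_i$ nor $n_j$ is divisible by $d$; or (ii) there is an index $j$ with $n_j/\lfloor n_j/d\rfloor > d+1$, where the quotient is a real (rational) quotient, and is read as $+\infty$ when $\lfloor n_j/d\rfloor = 0$ (so (ii) holds whenever $d>n_j$ for some $j$). Then $p(q: n_1,\ldots,n_k) = \lceil n_1/d \rceil+\cdots+\lceil n_k/d \rceil$. *)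

theory Defs
  imports Complex_Main
begin

text \<open>
  A finite, undirected, simple graph is a pair of a finite vertex set and a set of edges, each edge
  being a two-element set of vertices.
\<close>

type_synonym 'a graph = "'a set \<times> 'a set set"

definition verts :: "'a graph \<Rightarrow> 'a set" where
  "verts G = fst G"

definition edges :: "'a graph \<Rightarrow> 'a set set" where
  "edges G = snd G"

definition simple_graph :: "'a graph \<Rightarrow> bool" where
  "simple_graph G \<longleftrightarrow>
     finite (verts G) \<and> (\<forall>e \<in> edges G. e \<subseteq> verts G \<and> card e = 2)"

definition proper_coloring :: "'a graph \<Rightarrow> nat \<Rightarrow> ('a \<Rightarrow> nat) \<Rightarrow> bool" where
  "proper_coloring G q c \<longleftrightarrow>
     (\<forall>v \<in> verts G. c v < q) \<and> (\<forall>u v. {u, v} \<in> edges G \<longrightarrow> c u \<noteq> c v)"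

definition color_class :: "'a graph \<Rightarrow> ('a \<Rightarrow> nat) \<Rightarrow> nat \<Rightarrow> 'a set" where
  "color_class G c a = {v \<in> verts G. c v = a}"

text \<open>
  The size condition ranges over all \<open>q\<close> color classes, the empty ones included. In particular
  every color is used unless all classes have at most one vertex.
\<close>

definition equitable_coloring :: "'a graph \<Rightarrow> nat \<Rightarrow> ('a \<Rightarrow> nat) \<Rightarrow> bool" where
  "equitable_coloring G q c \<longleftrightarrow>
     proper_coloring G q c \<and>
     (\<forall>a < q. \<forall>b < q. card (color_class G c a) \<le> card (color_class G c b) + 1)"

definition equitably_colorable :: "'a graph \<Rightarrow> nat \<Rightarrow> bool" where
  "equitably_colorable G q \<longleftrightarrow> (\<exists>c. equitable_coloring G q c)"

text \<open>
  The complete \<open>k\<close>-partite graph with partite sets \<open>{i} \<times> {..<n i}\<close> for \<open>i \<in> {1..k}\<close>. Only the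
  values of \<open>n\<close> on \<open>{1..k}\<close> matter, here and below.
\<close>

definition complete_multipartite :: "nat \<Rightarrow> (nat \<Rightarrow> nat) \<Rightarrow> (nat \<times> nat) graph" where
  "complete_multipartite k n =
     (let V = (SIGMA i:{1..k}. {..<n i})
      in (V, {{u, v} | u v. u \<in> V \<and> v \<in> V \<and> fst u \<noteq> fst v}))"

lemma simple_graph_complete_multipartite: "simple_graph (complete_multipartite k n)"
  by (auto simp: simple_graph_def complete_multipartite_def verts_def edges_def Let_def card_2_iff)

lemma edges_complete_multipartite_iff:
  "{u, v} \<in> edges (complete_multipartite k n) \<longleftrightarrow>
     u \<in> verts (complete_multipartite k n) \<and> v \<in> verts (complete_multipartite k n) \<and>
     fst u \<noteq> fst v"
  unfolding complete_multipartite_def verts_def edges_def Let_def fst_conv snd_conv mem_Collect_eq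
  by (metis doubleton_eq_iff)

text \<open>
  The disjunct \<open>\<lfloor>n j / d\<rfloor> = 0\<close> is needed because the quotient is then read as \<open>+\<infinity>\<close>, whereas
  division by zero yields \<open>0\<close> in HOL.
\<close>

definition stops_at :: "nat \<Rightarrow> (nat \<Rightarrow> nat) \<Rightarrow> nat \<Rightarrow> bool" where
  "stops_at k n d \<longleftrightarrow>
     (\<exists>i \<in> {1..k}. \<exists>j \<in> {1..k}. i \<noteq> j \<and> \<not> d dvd n i \<and> \<not> d dvd n j) \<or>
     (\<exists>j \<in> {1..k}. \<lfloor>real (n j) / real d\<rfloor> = 0 \<or>
        real (n j) / real_of_int \<lfloor>real (n j) / real d\<rfloor> > real d + 1)"

text \<open>
  For \<open>k \<ge> 1\<close> the least \<open>d\<close> exists, since every \<open>d > n 1\<close> satisfies \<open>stops_at k n d\<close>; for positive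
  \<open>q\<close> and positive parts it is at least \<open>1\<close>, so taking it in the naturals loses nothing.
\<close>

definition p_step :: "nat \<Rightarrow> nat \<Rightarrow> (nat \<Rightarrow> nat) \<Rightarrow> nat" where
  "p_step q k n =
     (LEAST d. int d \<ge> \<lceil>real (\<Sum>i = 1..k. n i) / real q\<rceil> \<and> stops_at k n d)"

definition p_value :: "nat \<Rightarrow> nat \<Rightarrow> (nat \<Rightarrow> nat) \<Rightarrow> int" where
  "p_value q k n = (\<Sum>i = 1..k. \<lceil>real (n i) / real (p_step q k n)\<rceil>)"

definition is_minimum :: "'a::linorder \<Rightarrow> 'a set \<Rightarrow> bool" where
  "is_minimum m S \<longleftrightarrow> m \<in> S \<and> (\<forall>x \<in> S. m \<le> x)"

end

theory Submission
  imports Defs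
begin

text \<open>
  An equitable \<open>r\<close>-coloring of \<open>K\<^bsub>n\<^sub>1,\<dots>,n\<^sub>k\<^esub>\<close> with classes of size \<open>m\<close> and \<open>m + 1\<close> amounts to
  numbers \<open>\<rho>\<^sub>i\<close> of colors with sum \<open>r\<close> and \<open>m \<rho>\<^sub>i \<le> n\<^sub>i \<le> (m + 1) \<rho>\<^sub>i\<close>, that is
  \<open>\<lceil>n\<^sub>i / (m + 1)\<rceil> \<le> \<rho>\<^sub>i \<le> \<lfloor>n\<^sub>i / m\<rfloor>\<close>. Let \<open>f d = \<Sum>i. \<lceil>n\<^sub>i / d\<rceil>\<close>. The given \<open>q\<close>-coloring makes every
  \<open>r\<close> from \<open>f \<lceil>N / q\<rceil>\<close> to \<open>q\<close> admissible, where \<open>N = \<Sum>i. n\<^sub>i\<close>. If \<open>d\<close> satisfies neither (i) nor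
  (ii), then \<open>m = d\<close> makes every \<open>r\<close> from \<open>f (d + 1)\<close> to \<open>f d - 1\<close> admissible, so everything from
  \<open>f d\<close> to \<open>q\<close> is admissible for the first \<open>d\<close> satisfying (i) or (ii). For this \<open>d\<close>,
  \<open>r = f d - 1\<close> is not: \<open>f (m + 1) \<le> r\<close> forces \<open>m \<ge> d\<close>; the case \<open>m = d\<close> is excluded by (i) or
  (ii), and for \<open>m > d\<close> each \<open>\<lfloor>n\<^sub>i / m\<rfloor>\<close> is less than \<open>\<lceil>n\<^sub>i / d\<rceil>\<close>, so their sum is at most
  \<open>f d - k < r\<close>.
\<close>

section \<open>Even division into classes, and sums with a prescribed value\<close>

text \<open>Residue classes modulo \<open>s\<close> share out \<open>t\<close> elements evenly: with
  \<open>x = j * s + b\<close>, all \<open>j < m\<close> give elements below \<open>t\<close>, and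
  only \<open>j < m + 1\<close> can.\<close>

lemma card_mod_class_bounds:
  fixes m s t b :: nat
  assumes "m * s \<le> t" "t \<le> (m + 1) * s" "b < s"
  shows "m \<le> card {x. x < t \<and> x mod s = b}" "card {x. x < t \<and> x mod s = b} \<le> m + 1"
proof -
  have "(\<lambda>j. j * s + b) ` {..<m} \<subseteq> {x. x < t \<and> x mod s = b}"
  proof (clarsimp simp: assms(3))
    fix j assume "j < m"
    then have "Suc j * s \<le> m * s" by (intro mult_le_mono1) simp
    then show "j * s + b < t" using assms by simp
  qed
  moreover have "inj_on (\<lambda>j. j * s + b) {..<m}"
    using assms(3) by (auto simp: inj_on_def)
  ultimately show "m \<le> card {x. x < t \<and> x mod s = b}"
    using card_mono[of "{x. x < t \<and> x mod s = b}" "(\<lambda>j. j * s + b) ` {..<m}"]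
    by (simp add: card_image)
  have "{x. x < t \<and> x mod s = b} \<subseteq> (\<lambda>j. j * s + b) ` {..<m + 1}"
  proof
    fix x assume x: "x \<in> {x. x < t \<and> x mod s = b}"
    then have "x < (m + 1) * s" using assms by simp
    then have "x div s < m + 1" using assms(3) by (simp add: less_mult_imp_div_less)
    moreover have "x = x div s * s + b" using x by (metis (mono_tags) div_mult_mod_eq mem_Collect_eq)
    ultimately show "x \<in> (\<lambda>j. j * s + b) ` {..<m + 1}" by blast
  qed
  then show "card {x. x < t \<and> x mod s = b} \<le> m + 1"
    using surj_card_le[of "{..<m + 1}" _ "\<lambda>j. j * s + b"] by simp
qed

text \<open>A discrete intermediate value argument; it yields every total number of colors between
  two extreme distributions over the parts.\<close>

lemma exists_interpolating_sum:
  fixes l u :: "'a \<Rightarrow> nat"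
  assumes "finite A" "\<And>i. i \<in> A \<Longrightarrow> l i \<le> u i" "sum l A \<le> r" "r \<le> sum u A"
  shows "\<exists>\<rho>. (\<forall>i\<in>A. l i \<le> \<rho> i \<and> \<rho> i \<le> u i) \<and> sum \<rho> A = r"
  using assms
proof (induction A arbitrary: r rule: finite_induct)
  case (insert a A)
  have le: "sum l A \<le> sum u A" by (intro sum_mono insert.prems(1)) simp
  \<comment> \<open>The least admissible value at \<open>a\<close> that leaves at most
    \<open>sum u A\<close> for the rest; truncated subtraction gives 0 when \<open>r\<close> is
    already that small.\<close>
  define x where "x = max (l a) (r - sum u A)"
  have *: "l a \<le> u a" using insert.prems(1) by simp
  have "sum l A \<le> r - x" "r - x \<le> sum u A" "x \<le> r" "l a \<le> x" "x \<le> u a"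
    using insert.prems(2,3) insert.hyps le * unfolding x_def by auto
  moreover obtain \<rho> where "\<forall>i\<in>A. l i \<le> \<rho> i \<and> \<rho> i \<le> u i" "sum \<rho> A = r - x"
    using insert.IH[of "r - x"] insert.prems(1) calculation by auto
  moreover have "sum (\<rho>(a := x)) A = sum \<rho> A"
    using insert.hyps by (intro sum.cong) auto
  ultimately show ?case using insert.hyps
    by (intro exI[of _ "\<rho>(a := x)"]) auto
qed simp

section \<open>Equitable colorings as distributions of colors over the parts\<close>

definition split_into :: "nat \<Rightarrow> (nat \<Rightarrow> nat) \<Rightarrow> nat \<Rightarrow> (nat \<Rightarrow> nat) \<Rightarrow> bool" where
  "split_into k n m \<rho> \<longleftrightarrow> (\<forall>i\<in>{1..k}. m * \<rho> i \<le> n i \<and> n i \<le> (m + 1) * \<rho> i)"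

text \<open>Each part gets its own palette of \<open>\<rho> i\<close> colors, used cyclically, so
  every color class is a residue class within one part.\<close>

lemma equitably_colorable_if_split:
  assumes pos: "\<forall>i\<in>{1..k}. n i > 0" and split: "split_into k n m \<rho>"
    and sum: "sum \<rho> {1..k} = r"
  shows "equitably_colorable (complete_multipartite k n) r"
proof -
  let ?G = "complete_multipartite k n"
  define C where "C = (SIGMA i:{1..k}. {..<\<rho> i})"
  have "finite C" "card C = r" using sum by (auto simp: C_def)
  then obtain h where h: "bij_betw h C {..<r}"
    by (metis bij_betw_iff_card card_lessThan finite_lessThan)
  \<comment> \<open>Since \<open>x mod 0 = x\<close> in HOL, positivity is what keeps
    \<open>x mod \<rho> i\<close> inside the palette.\<close>
  have \<rho>_pos: "\<rho> i > 0" if "i \<in> {1..k}" for i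
    using pos split that unfolding split_into_def by (metis gr0I mult_0_right not_le)
  define c where "c = (\<lambda>(i, x). h (i, x mod \<rho> i))"
  have V: "verts ?G = (SIGMA i:{1..k}. {..<n i})"
    by (simp add: verts_def complete_multipartite_def Let_def)
  have mem: "(i, x mod \<rho> i) \<in> C" if "i \<in> {1..k}" for i x
    using \<rho>_pos[OF that] that by (simp add: C_def)
  have inj: "inj_on h C" using h by (rule bij_betw_imp_inj_on)
  have "proper_coloring ?G r c"
    unfolding proper_coloring_def
  proof (intro conjI ballI allI impI)
    fix v assume "v \<in> verts ?G"
    then show "c v < r"
      using mem bij_betwE[OF h] unfolding V c_def by auto
  next
    fix u v assume "{u, v} \<in> edges ?G"
    then have "u \<in> verts ?G" "v \<in> verts ?G" "fst u \<noteq> fst v"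
      by (auto simp: edges_complete_multipartite_iff)
    moreover obtain i x j y where "u = (i, x)" "v = (j, y)" by (meson surj_pair)
    ultimately show "c u \<noteq> c v"
      using inj_on_eq_iff[OF inj mem mem, of i j x y] by (simp add: V c_def)
  qed
  moreover have "m \<le> card (color_class ?G c a) \<and> card (color_class ?G c a) \<le> m + 1" if "a < r" for a
  proof -
    have "a \<in> h ` C" using h that by (simp add: bij_betw_def)
    then obtain i b where ib: "(i, b) \<in> C" "h (i, b) = a" by auto
    have i: "i \<in> {1..k}" and b: "b < \<rho> i" using ib by (auto simp: C_def)
    have "color_class ?G c a = Pair i ` {x. x < n i \<and> x mod \<rho> i = b}"
    proof -
      have "h (j, x mod \<rho> j) = a \<longleftrightarrow> j = i \<and> x mod \<rho> i = b" if "j \<in> {1..k}" for j x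
        using inj_on_eq_iff[OF inj mem[OF that] ib(1)] ib(2) by auto
      then have "(j, x) \<in> color_class ?G c a \<longleftrightarrow> j = i \<and> x < n i \<and> x mod \<rho> i = b" for j x
        using i unfolding color_class_def V c_def by auto
      then show ?thesis by auto
    qed
    then have "card (color_class ?G c a) = card {x. x < n i \<and> x mod \<rho> i = b}"
      by (simp add: card_image inj_on_def)
    then show ?thesis
      using card_mod_class_bounds[of m "\<rho> i" "n i" b] split i b unfolding split_into_def by auto
  qed
  ultimately have "equitable_coloring ?G r c"
    unfolding equitable_coloring_def by (meson add_le_mono1 le_trans)
  then show ?thesis unfolding equitably_colorable_def by blast
qed

text \<open>Distinct parts are completely joined, so a color class lies in a single part; counting
  the colors by part gives \<open>\<rho>\<close>.\<close>

lemma split_if_equitably_colorable: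
  assumes "k \<ge> 1" "r > 0"
    and "equitably_colorable (complete_multipartite k n) r"
  shows "\<exists>m \<rho>. split_into k n m \<rho> \<and> sum \<rho> {1..k} = r"
proof -
  let ?G = "complete_multipartite k n"
  obtain c where c: "equitable_coloring ?G r c"
    using assms(3) unfolding equitably_colorable_def by blast
  let ?K = "color_class ?G c"
  have V: "verts ?G = (SIGMA i:{1..k}. {..<n i})"
    by (simp add: verts_def complete_multipartite_def Let_def)
  have c_less: "c v < r" if "v \<in> verts ?G" for v
    using c that unfolding equitable_coloring_def proper_coloring_def by blast
  have same_part: "fst u = fst v" if "u \<in> ?K a" "v \<in> ?K a" for u v a
  proof (rule ccontr)
    assume "fst u \<noteq> fst v"
    then have "{u, v} \<in> edges ?G"
      using that by (simp add: edges_complete_multipartite_iff color_class_def)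
    then have "c u \<noteq> c v"
      using c unfolding equitable_coloring_def proper_coloring_def by blast
    then show False using that by (simp add: color_class_def)
  qed
  \<comment> \<open>A color class may be empty. Assigning it to part 1 keeps the total number of
    colors at \<open>r\<close> and adds no vertices to that part.\<close>
  define \<phi> where "\<phi> a = (if ?K a = {} then 1 else fst (SOME v. v \<in> ?K a))" for a
  have \<phi>: "\<phi> a = fst v" if "v \<in> ?K a" for a v
  proof -
    have "(SOME v. v \<in> ?K a) \<in> ?K a" using that by (rule someI)
    then show ?thesis using same_part that unfolding \<phi>_def by (metis empty_iff)
  qed
  have \<phi>_range: "\<phi> a \<in> {1..k}" for a
  proof (cases "?K a = {}")
    case False
    then obtain v where v: "v \<in> ?K a" by blast
    then have "fst v \<in> {1..k}" unfolding color_class_def V by auto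
    then show ?thesis using \<phi>[OF v] by simp
  qed (use assms in \<open>auto simp: \<phi>_def\<close>)
  define S where "S i = {a. a < r \<and> \<phi> a = i}" for i
  define m where "m = Min ((\<lambda>a. card (?K a)) ` {..<r})"
  have bounds: "m \<le> card (?K a) \<and> card (?K a) \<le> m + 1" if "a < r" for a
  proof -
    have "m \<in> (\<lambda>a. card (?K a)) ` {..<r}"
      unfolding m_def using assms(2) by (intro Min_in) auto
    then obtain b where "b < r" "m = card (?K b)" by auto
    moreover have "m \<le> card (?K a)" unfolding m_def using that by (intro Min_le) auto
    ultimately show ?thesis using c that unfolding equitable_coloring_def by auto
  qed
  have size: "n i = (\<Sum>a\<in>S i. card (?K a))" if "i \<in> {1..k}" for i
  proof -
    have "Pair i ` {..<n i} = (\<Union>a\<in>S i. ?K a)"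
    proof (intro equalityI subsetI)
      fix v assume v: "v \<in> Pair i ` {..<n i}"
      then have "v \<in> verts ?G" using that unfolding V by auto
      moreover from this have "v \<in> ?K (c v)" by (simp add: color_class_def)
      moreover have "fst v = i" using v by auto
      ultimately show "v \<in> (\<Union>a\<in>S i. ?K a)" using c_less \<phi> unfolding S_def by blast
    next
      fix v assume "v \<in> (\<Union>a\<in>S i. ?K a)"
      then obtain a where a: "\<phi> a = i" "v \<in> ?K a" unfolding S_def by blast
      then have "fst v = i" "v \<in> verts ?G" using \<phi>[OF a(2)] by (auto simp: color_class_def)
      then show "v \<in> Pair i ` {..<n i}" unfolding V by auto
    qed
    moreover have "card (Pair i ` {..<n i}) = n i" by (simp add: card_image inj_on_def)
    moreover have "card (\<Union>a\<in>S i. ?K a) = (\<Sum>a\<in>S i. card (?K a))"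
      by (intro card_UN_disjoint) (auto simp: S_def color_class_def V)
    ultimately show ?thesis by simp
  qed
  have "split_into k n m (\<lambda>i. card (S i))"
    unfolding split_into_def
  proof (intro ballI conjI)
    fix i assume i: "i \<in> {1..k}"
    show "m * card (S i) \<le> n i"
      unfolding size[OF i]
      using sum_bounded_below[of "S i" m "\<lambda>a. card (?K a)"] bounds by (auto simp: S_def mult.commute)
    show "n i \<le> (m + 1) * card (S i)"
      unfolding size[OF i]
      using sum_bounded_above[of "S i" "\<lambda>a. card (?K a)" "m + 1"] bounds
      by (auto simp: S_def mult.commute)
  qed
  moreover have "(\<Sum>i=1..k. card (S i)) = r"
  proof -
    have "(\<Sum>i=1..k. card (S i)) = card (\<Union>i\<in>{1..k}. S i)"
      by (intro card_UN_disjoint[symmetric]) (auto simp: S_def)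
    also have "(\<Union>i\<in>{1..k}. S i) = {..<r}" using \<phi>_range by (auto simp: S_def)
    finally show ?thesis by simp
  qed
  ultimately show ?thesis by blast
qed

section \<open>Rounded-up quotients and the stopping condition over the naturals\<close>

definition ceil_div :: "nat \<Rightarrow> nat \<Rightarrow> nat" where
  "ceil_div a d = nat \<lceil>real a / real d\<rceil>"

lemma ceil_div_le_iff: "d > 0 \<Longrightarrow> ceil_div a d \<le> r \<longleftrightarrow> a \<le> d * r"
  unfolding ceil_div_def nat_ceiling_le_eq
  by (simp add: divide_le_eq mult.commute flip: of_nat_mult)

lemma less_ceil_div_iff: "d > 0 \<Longrightarrow> r < ceil_div a d \<longleftrightarrow> d * r < a"
  using ceil_div_le_iff[of d a r] by linarith

lemma ceil_div_dvd: "d > 0 \<Longrightarrow> d dvd a \<Longrightarrow> ceil_div a d = a div d"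
  unfolding ceil_div_def by (simp flip: real_of_nat_div)

lemma ceil_div_le_Suc_div: "d > 0 \<Longrightarrow> ceil_div a d \<le> a div d + 1"
  using mod_less_divisor[of d a] mult_div_mod_eq[of d a]
  unfolding ceil_div_le_iff distrib_left mult_1_right by linarith

lemma div_less_ceil_div: "d > 0 \<Longrightarrow> \<not> d dvd a \<Longrightarrow> a div d < ceil_div a d"
  unfolding less_ceil_div_iff by (metis dvd_triv_left le_neq_implies_less times_div_less_eq_dividend)

lemma div_le_ceil_div: "d > 0 \<Longrightarrow> a div d \<le> ceil_div a d"
  using ceil_div_dvd div_less_ceil_div by (metis le_less)

text \<open>Where the floor is positive, the quotient in (ii) is cross-multiplied; floor zero, the
  infinite quotient, stays a separate case.\<close>

lemma stops_at_iff:
  assumes "d > 0"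
  shows "stops_at k n d \<longleftrightarrow>
    (\<exists>i\<in>{1..k}. \<exists>j\<in>{1..k}. i \<noteq> j \<and> \<not> d dvd n i \<and> \<not> d dvd n j) \<or>
    (\<exists>j\<in>{1..k}. n j div d = 0 \<or> (d + 1) * (n j div d) < n j)"
proof -
  have "\<lfloor>real a / real d\<rfloor> = 0 \<or> real a / real_of_int \<lfloor>real a / real d\<rfloor> > real d + 1 \<longleftrightarrow>
    a div d = 0 \<or> (d + 1) * (a div d) < a" for a
  proof (cases "a div d = 0")
    case False
    then have pos: "0 < real (a div d)" by simp
    have "real a / real (a div d) > real d + 1 \<longleftrightarrow> real ((d + 1) * (a div d)) < real a"
      unfolding of_nat_mult of_nat_add of_nat_1 by (rule pos_less_divide_eq[OF pos])
    then show ?thesis unfolding floor_divide_of_nat_eq of_nat_less_iff by simp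
  qed (simp add: floor_divide_of_nat_eq)
  then show ?thesis unfolding stops_at_def by simp
qed

lemma ceiling_div_le_int_iff:
  assumes "b > 0"
  shows "int d \<ge> \<lceil>real a / real b\<rceil> \<longleftrightarrow> a \<le> b * d"
  using ceil_div_le_iff[OF assms, of a d] unfolding ceil_div_def by linarith

section \<open>Attainable numbers of colors\<close>

definition color_count :: "nat \<Rightarrow> (nat \<Rightarrow> nat) \<Rightarrow> nat \<Rightarrow> nat" where
  "color_count k n d = (\<Sum>i=1..k. ceil_div (n i) d)"

text \<open>With \<open>m\<close> fixed, taking colors away from a part preserves the lower bound on
  its size, and the upper bound survives down to \<open>ceil_div (n i) (m + 1)\<close> colors.
  Interpolation reaches every total in between.\<close>

lemma colorable_down_to_color_count:
  assumes "split_into k n m \<rho>" "sum \<rho> {1..k} = s" "color_count k n (m + 1) \<le> r" "r \<le> s"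
    and pos: "\<forall>i\<in>{1..k}. n i > 0"
  shows "equitably_colorable (complete_multipartite k n) r"
proof -
  have "ceil_div (n i) (m + 1) \<le> \<rho> i" if "i \<in> {1..k}" for i
    using assms(1) that by (simp add: ceil_div_le_iff split_into_def)
  then obtain \<sigma> where \<sigma>: "\<forall>i\<in>{1..k}. ceil_div (n i) (m + 1) \<le> \<sigma> i \<and> \<sigma> i \<le> \<rho> i"
      "sum \<sigma> {1..k} = r"
    using exists_interpolating_sum[of "{1..k}" "\<lambda>i. ceil_div (n i) (m + 1)" \<rho> r] assms
    unfolding color_count_def by auto
  have "m * \<sigma> i \<le> n i \<and> n i \<le> (m + 1) * \<sigma> i" if "i \<in> {1..k}" for i
  proof
    have "m * \<sigma> i \<le> m * \<rho> i" using \<sigma>(1) that by simp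
    also have "\<dots> \<le> n i" using assms(1) that by (simp add: split_into_def)
    finally show "m * \<sigma> i \<le> n i" .
    show "n i \<le> (m + 1) * \<sigma> i" using \<sigma>(1) that ceil_div_le_iff[of "m + 1"] by simp
  qed
  then show ?thesis
    using equitably_colorable_if_split[OF pos _ \<sigma>(2), where m = m] by (simp add: split_into_def)
qed

text \<open>The start of the descent. The average class size lies between \<open>m\<close> and
  \<open>m + 1\<close>, so \<open>d\<close> is one of these. For \<open>m + 1\<close> the colors can
  be reduced as before; for \<open>m\<close> all classes have size exactly \<open>m\<close> and the
  range shrinks to \<open>r = q\<close>.\<close>

lemma colorable_from_initial_color_count:
  assumes "equitably_colorable (complete_multipartite k n) q"
    and d: "d = ceil_div (\<Sum>i=1..k. n i) q"
    and k: "k \<ge> 1" and q: "q > 0" and pos: "\<forall>i\<in>{1..k}. n i > 0"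
  shows "color_count k n d \<le> q"
    and "color_count k n d \<le> r \<Longrightarrow> r \<le> q \<Longrightarrow> equitably_colorable (complete_multipartite k n) r"
proof -
  let ?N = "\<Sum>i=1..k. n i"
  obtain m \<rho> where sp: "split_into k n m \<rho>" and \<rho>: "sum \<rho> {1..k} = q"
    using split_if_equitably_colorable[OF _ q assms(1)] k by auto
  have "(\<Sum>i=1..k. m * \<rho> i) \<le> ?N" "?N \<le> (\<Sum>i=1..k. (m + 1) * \<rho> i)"
    using sp by (auto intro!: sum_mono simp: split_into_def)
  then have N: "m * q \<le> ?N" "?N \<le> (m + 1) * q"
    by (simp_all only: flip: sum_distrib_left \<rho>)
  have "d \<le> m + 1" unfolding d ceil_div_le_iff[OF q] using N by (simp add: mult.commute)
  moreover have Nd: "?N \<le> q * d" using ceil_div_le_iff[OF q, of ?N d] d by simp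
  moreover have "m \<le> d" using N(1) Nd q by (metis le_trans mult.commute mult_le_cancel1)
  ultimately consider "d = m + 1" | "d = m" by linarith
  then have "color_count k n d \<le> q \<and> (color_count k n d \<le> r \<longrightarrow> r \<le> q \<longrightarrow>
      equitably_colorable (complete_multipartite k n) r)" for r
  proof cases
    case 1
    have "color_count k n d \<le> q" unfolding color_count_def \<rho>[symmetric]
      using sp 1 by (intro sum_mono) (simp add: ceil_div_le_iff split_into_def)
    then show ?thesis using colorable_down_to_color_count[OF sp \<rho> _ _ pos] 1 by auto
  next
    case 2
    \<comment> \<open>The sums agree, so each inequality \<open>m * \<rho> i \<le> n i\<close> must
      be an equality.\<close>
    then have eq: "(\<Sum>i=1..k. m * \<rho> i) = ?N"
      unfolding sum_distrib_left[symmetric] \<rho> using N(1) Nd by (simp add: mult.commute)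
    have n_eq: "n i = m * \<rho> i" if "i \<in> {1..k}" for i
    proof (rule ccontr)
      assume "n i \<noteq> m * \<rho> i"
      then have "(\<Sum>i=1..k. m * \<rho> i) < ?N"
        using sp that unfolding split_into_def
        by (intro sum_strict_mono_ex1) (auto intro!: bexI[of _ i] simp: le_neq_implies_less)
      then show False using eq by simp
    qed
    have "n 1 = m * \<rho> 1" "n 1 > 0" using k by (auto intro!: n_eq bspec[OF pos])
    then have m: "m > 0" by (cases m) auto
    have "color_count k n d = sum \<rho> {1..k}"
      unfolding color_count_def using n_eq m 2 by (intro sum.cong) (auto simp: ceil_div_dvd)
    then show ?thesis using assms(1) \<rho> by auto
  qed
  then show "color_count k n d \<le> q"
    and "color_count k n d \<le> r \<Longrightarrow> r \<le> q \<Longrightarrow> equitably_colorable (complete_multipartite k n) r"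
    by auto
qed

lemma color_count_antimono:
  assumes "0 < d" "d \<le> e"
  shows "color_count k n e \<le> color_count k n d"
  unfolding color_count_def
proof (rule sum_mono)
  fix i
  have "n i \<le> d * ceil_div (n i) d" using ceil_div_le_iff[OF assms(1)] by blast
  also have "\<dots> \<le> e * ceil_div (n i) d" using assms(2) by simp
  finally show "ceil_div (n i) e \<le> ceil_div (n i) d" using assms ceil_div_le_iff[of e] by simp
qed

text \<open>Failure of (ii) makes the floors \<open>n i div d\<close> a valid distribution with
  class sizes \<open>d\<close> and \<open>d + 1\<close>; failure of (i) makes their sum at least
  \<open>color_count k n d - 1\<close>.\<close>

lemma colorable_between_color_counts:
  assumes "d > 0" "\<not> stops_at k n d" "color_count k n (d + 1) \<le> r" "r < color_count k n d"
    and pos: "\<forall>i\<in>{1..k}. n i > 0"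
  shows "equitably_colorable (complete_multipartite k n) r"
proof -
  have "split_into k n d (\<lambda>i. n i div d)"
    using assms(2) unfolding stops_at_iff[OF assms(1)] split_into_def by (auto simp: not_less)
  \<comment> \<open>At most one part is not divisible by \<open>d\<close>, and only there do floor
    and ceiling differ, by one.\<close>
  moreover have "color_count k n d \<le> (\<Sum>i=1..k. n i div d) + 1"
  proof (cases "\<exists>j\<in>{1..k}. \<not> d dvd n j")
    case True
    then obtain j where j: "j \<in> {1..k}" "\<not> d dvd n j" by blast
    have "d dvd n i" if "i \<in> {1..k} - {j}" for i
      using assms(2) that j unfolding stops_at_iff[OF assms(1)] by blast
    then have "(\<Sum>i\<in>{1..k} - {j}. ceil_div (n i) d) = (\<Sum>i\<in>{1..k} - {j}. n i div d)"
      by (intro sum.cong) (auto simp: ceil_div_dvd[OF assms(1)])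
    then show ?thesis
      using sum.remove[OF finite_atLeastAtMost j(1), of "\<lambda>i. ceil_div (n i) d"]
        sum.remove[OF finite_atLeastAtMost j(1), of "\<lambda>i. n i div d"] ceil_div_le_Suc_div[OF assms(1), of "n j"]
      unfolding color_count_def by linarith
  next
    case False
    then show ?thesis unfolding color_count_def by (simp add: ceil_div_dvd[OF assms(1)])
  qed
  ultimately show ?thesis
    using colorable_down_to_color_count[OF _ refl assms(3) _ pos] assms(4) by simp
qed

text \<open>Induction on \<open>d\<close>: each value that does not stop fills the gap between two
  consecutive color counts.\<close>

lemma colorable_from_color_count:
  assumes "equitably_colorable (complete_multipartite k n) q"
    and d0: "d0 = ceil_div (\<Sum>i=1..k. n i) q" "d0 > 0"
    and "d0 \<le> d" "\<And>e. d0 \<le> e \<Longrightarrow> e < d \<Longrightarrow> \<not> stops_at k n e"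
    and "color_count k n d \<le> r" "r \<le> q"
    and k: "k \<ge> 1" and q: "q > 0" and pos: "\<forall>i\<in>{1..k}. n i > 0"
  shows "equitably_colorable (complete_multipartite k n) r"
  using assms(4-6)
proof (induction d rule: dec_induct)
  case base
  then show ?case using colorable_from_initial_color_count(2)[OF assms(1) d0(1) k q pos] assms(7) by blast
next
  case (step d)
  then show ?case
    using colorable_between_color_counts[of d k n r] d0(2) pos by (cases "color_count k n d \<le> r") auto
qed

section \<open>Failure just below the color count\<close>

lemma sum_add_two_le_color_count:
  assumes le: "\<And>i. i \<in> {1..k} \<Longrightarrow> \<rho> i \<le> ceil_div (n i) d"
    and ij: "i \<in> {1..k}" "j \<in> {1..k}" "i \<noteq> j" "\<rho> i < ceil_div (n i) d" "\<rho> j < ceil_div (n j) d"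
  shows "sum \<rho> {1..k} + 2 \<le> color_count k n d"
proof -
  have split: "sum g {1..k} = g i + (g j + sum g ({1..k} - {i} - {j}))" for g :: "nat \<Rightarrow> nat"
    using ij by (subst sum.remove[of _ i], simp, simp, subst sum.remove[of _ j]) auto
  have "sum \<rho> ({1..k} - {i} - {j}) \<le> (\<Sum>i\<in>{1..k} - {i} - {j}. ceil_div (n i) d)"
    by (intro sum_mono le) auto
  then show ?thesis unfolding color_count_def split using ij by linarith
qed

lemma not_colorable_below_color_count:
  assumes "d > 0" "stops_at k n d" "r > 0" "r + 1 = color_count k n d"
    and k: "k \<ge> 2" and pos: "\<forall>i\<in>{1..k}. n i > 0"
  shows "\<not> equitably_colorable (complete_multipartite k n) r"
proof
  assume col: "equitably_colorable (complete_multipartite k n) r"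
  obtain m \<rho> where sp: "split_into k n m \<rho>" and \<rho>: "sum \<rho> {1..k} = r"
    using split_if_equitably_colorable[OF _ assms(3) col] k by auto
  have lower: "ceil_div (n i) (m + 1) \<le> \<rho> i" if "i \<in> {1..k}" for i
    using sp that by (simp add: ceil_div_le_iff split_into_def)
  have "color_count k n (m + 1) \<le> r"
    unfolding color_count_def \<rho>[symmetric] by (intro sum_mono lower)
  \<comment> \<open>Otherwise \<open>m + 1 \<le> d\<close>, and antitonicity would give
    \<open>color_count k n d \<le> r\<close>.\<close>
  then have "d \<le> m" using color_count_antimono[of "m + 1" d k n] assms(4) by (cases "d \<le> m") auto
  then have upper: "\<rho> i \<le> n i div d" if "i \<in> {1..k}" for i
    using sp that assms(1) unfolding split_into_def
    by (metis div_le_mono le_trans less_eq_div_iff_mult_less_eq mult.commute mult_le_mono1)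
  have le: "\<rho> i \<le> ceil_div (n i) d" if "i \<in> {1..k}" for i
    using upper[OF that] div_le_ceil_div[OF assms(1)] le_trans by blast
  \<comment> \<open>The total \<open>r\<close> is only one below the color count, so two parts
    cannot both fall short of their ceilings.\<close>
  have two: False
    if "i \<in> {1..k}" "j \<in> {1..k}" "i \<noteq> j" "\<rho> i < ceil_div (n i) d" "\<rho> j < ceil_div (n j) d" for i j
    using sum_add_two_le_color_count[OF le that] assms(4) \<rho> by simp
  show False
  proof (cases "m = d")
    case True
    \<comment> \<open>The distribution itself refutes (ii), so (i) must hold; its two parts have
      floors below their ceilings, contradicting \<open>two\<close>.\<close>
    have "\<not> (n j div d = 0 \<or> (d + 1) * (n j div d) < n j)" if "j \<in> {1..k}" for j
    proof -
      have "n j \<le> (d + 1) * \<rho> j" using sp that True by (simp add: split_into_def)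
      also have "\<dots> \<le> (d + 1) * (n j div d)" using upper[OF that] by (intro mult_le_mono2)
      finally show ?thesis using bspec[OF pos that] by (metis mult_0_right not_le)
    qed
    then show False
      using assms(2) two upper div_less_ceil_div[OF assms(1)]
      unfolding stops_at_iff[OF assms(1)] by (meson le_less_trans)
  next
    case False
    \<comment> \<open>Classes larger than \<open>d\<close> make every part fall short; as
      \<open>k \<ge> 2\<close>, parts 1 and 2 suffice for the contradiction.\<close>
    have "\<rho> i < ceil_div (n i) d" if i: "i \<in> {1..k}" for i
    proof (cases "\<rho> i = 0")
      case False
      then have "d * \<rho> i < m * \<rho> i" using \<open>d \<le> m\<close> \<open>m \<noteq> d\<close> by simp
      also have "\<dots> \<le> n i" using sp i by (simp add: split_into_def)
      finally show ?thesis by (simp add: less_ceil_div_iff[OF assms(1)])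
    qed (use bspec[OF pos i] in \<open>simp add: less_ceil_div_iff[OF assms(1)]\<close>)
    then show False using two[of 1 2] k by simp
  qed
qed

section \<open>Identification of the minimum\<close>

lemma p_value_eq: "p_value q k n = int (color_count k n (p_step q k n))"
proof -
  \<comment> \<open>Hence the ceilings are nonnegative, and \<open>nat\<close> in
    \<open>ceil_div\<close> loses nothing.\<close>
  have "- 1 < real a / real b" for a b
    using divide_nonneg_nonneg[of "real a" "real b"] by linarith
  then show ?thesis
    unfolding p_value_def color_count_def ceil_div_def of_nat_sum by (simp add: less_ceiling_iff)
qed

theorem theorem3:
  fixes k q :: nat and n :: "nat \<Rightarrow> nat"
  assumes "k \<ge> 2"
    and "\<And>i. i \<in> {1..k} \<Longrightarrow> n i > 0"
    and "q > 0"
    and "equitably_colorable (complete_multipartite k n) q"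
  shows "is_minimum (p_value q k n)
           {int p | p :: nat. 0 < p \<and> p \<le> q \<and>
              (\<forall>r :: nat. p \<le> r \<and> r \<le> q \<longrightarrow> equitably_colorable (complete_multipartite k n) r)}"
proof -
  let ?N = "\<Sum>i=1..k. n i"
  let ?ok = "\<lambda>p. \<forall>r. p \<le> r \<and> r \<le> q \<longrightarrow> equitably_colorable (complete_multipartite k n) r"
  define d0 where "d0 = ceil_div ?N q"
  define D where "D = p_step q k n"
  let ?f = "color_count k n"
  have pos: "\<forall>i\<in>{1..k}. n i > 0" using assms(2) by blast
  have k1: "k \<ge> 1" using assms(1) by simp
  have one: "1 \<in> {1..k}" using assms(1) by simp
  have "n 1 \<le> ?N" using one by (intro member_le_sum) auto
  then have d0: "d0 > 0" unfolding d0_def less_ceil_div_iff[OF assms(3)]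
    using assms(2)[OF one] by simp
  have D_eq: "D = (LEAST d. d0 \<le> d \<and> stops_at k n d)"
    unfolding D_def p_step_def d0_def ceil_div_le_iff[OF assms(3)]
      ceiling_div_le_int_iff[OF assms(3)] ..
  \<comment> \<open>A witness for \<open>LEAST\<close>: it is at least \<open>d0\<close>, and it
    exceeds \<open>n 1\<close>, so the floor for part 1 is zero.\<close>
  have "stops_at k n (d0 + n 1)"
    unfolding stops_at_iff[OF trans_less_add1[OF d0]] using one d0 assms(2)[OF one] by (intro disjI2 bexI[of _ 1]) auto
  then have D: "d0 \<le> D" "stops_at k n D"
    unfolding D_eq using LeastI[of "\<lambda>d. d0 \<le> d \<and> stops_at k n d" "d0 + n 1"] by auto
  have before: "\<not> stops_at k n e" if "d0 \<le> e" "e < D" for e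
    using not_less_Least[OF that(2)[unfolded D_eq]] that(1) by blast
  have "0 < ceil_div (n 1) D"
    using d0 D(1) assms(2)[OF one] by (subst less_ceil_div_iff) auto
  also have "\<dots> \<le> ?f D"
    unfolding color_count_def using one by (intro member_le_sum) auto
  finally have f_pos: "0 < ?f D" .
  have f_le: "?f D \<le> q"
    using color_count_antimono[OF d0 D(1), of k n] colorable_from_initial_color_count(1)[OF assms(4) d0_def k1 assms(3) pos]
    by (meson le_trans)
  have ok: "?ok (?f D)"
    using colorable_from_color_count[OF assms(4) d0_def d0 D(1) before _ _ k1 assms(3) pos] by blast
  have least: "?f D \<le> p" if p: "0 < p" "?ok p" for p
  proof (rule ccontr)
    assume "\<not> ?f D \<le> p"
    \<comment> \<open>The number \<open>?f D - 1\<close> would lie between \<open>p\<close> and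
      \<open>q\<close>, hence be attainable; \<open>p > 0\<close> makes it positive, as the
      non-colorability lemma demands.\<close>
    then have "p \<le> ?f D - 1" "?f D - 1 > 0" "?f D - 1 + 1 = ?f D" using p by auto
    then show False
      using not_colorable_below_color_count[OF _ D(2) _ _ assms(1) pos, of "?f D - 1"] d0 D(1) p(2) f_le
      by auto
  qed
  have "is_minimum (int (?f D)) {int p | p. 0 < p \<and> p \<le> q \<and> ?ok p}"
    unfolding is_minimum_def
  proof (intro conjI ballI)
    show "int (?f D) \<in> {int p | p. 0 < p \<and> p \<le> q \<and> ?ok p}" using f_pos f_le ok by blast
  next
    fix x assume "x \<in> {int p | p. 0 < p \<and> p \<le> q \<and> ?ok p}"
    then obtain p where "x = int p" "0 < p" "?ok p" by blast
    then show "int (?f D) \<le> x" using least by (simp only: of_nat_le_iff)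
  qed
  then show ?thesis unfolding p_value_eq D_def .
qed

end
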